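(* The dcpo $P=2^{<\omega}\mathbin{\dot\cup}[0,1]$ (with the binary-expansion order defined in the context) is not quasialgebraic.
   Context: Let $T=2^{<\omega}$ be the set of finite binary words with the prefix order $\preccurlyeq$, and $X=2^\omega$ the set of infinite binary sequences. For $s\in T$, $[s]=\{\alpha\in X: s \text{ is a prefix of }\alpha\}$. Let $\pi:X\to[0,1]$, $\pi(\alpha)=\sum_{n=0}^\infty \alpha(n)/2^{n+1}$. The poset $P=T\mathbin{\dot\cup}[0,1]$ (disjoint union) is ordered by: for $s,t\in T$, $s\le t$ iff $s\preccurlyeq t$; for $s\in T$, $r\in[0,1]$, $s\le r$ iff $r\in\pi([s])$; for $r,q\in[0,1]$, $r\le q$ iff $r=q$; no other comparabilities. It is a dcpo (every nonempty directed subset has a supremum). $\uparrow A=\{p\in P:\exists a\in A,\ a\le p\}$, $\uparrow x=\uparrow\{x\}$. For $A,B\subseteq P$, $A\ll B$ means: for every (nonempty) directed $D\subseteq P$, $\bigvee D\in\uparrow B$ implies $D\cap\uparrow A\ne\varnothing$. A family of sets is filtered under inclusion if it is nonempty and any two members contain a common member. A dcpo $P$ is quasialgebraic if for every $x\in P$ the family $\{\uparrow F: F\subseteq P\text{ finite}, x\in\uparrow F, F\ll F\}$ is filtered under inclusion and has intersection $\uparrow x$. *)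

theory Defs
  imports Complex_Main "HOL-Library.Sublist" "HOL-Algebra.Order"
begin

section \<open>Dcpos and quasialgebraicity\<close>

definition directed :: "('a, 'b) gorder_scheme \<Rightarrow> 'a set \<Rightarrow> bool" where
  "directed L D \<longleftrightarrow> D \<subseteq> carrier L \<and> D \<noteq> {} \<and>
     (\<forall>x\<in>D. \<forall>y\<in>D. \<exists>z\<in>D. x \<sqsubseteq>\<^bsub>L\<^esub> z \<and> y \<sqsubseteq>\<^bsub>L\<^esub> z)"

definition dcpo :: "('a, 'b) gorder_scheme \<Rightarrow> bool" where
  "dcpo L \<longleftrightarrow> partial_order L \<and> (\<forall>D. directed L D \<longrightarrow> (\<exists>d. is_lub L d D))"

definition up :: "('a, 'b) gorder_scheme \<Rightarrow> 'a set \<Rightarrow> 'a set" where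
  "up L A = {p \<in> carrier L. \<exists>a\<in>A. a \<sqsubseteq>\<^bsub>L\<^esub> p}"

text \<open>The supremum of \<open>D\<close> is referred to through \<open>is_lub\<close>; in a dcpo it exists and is unique.\<close>

definition way_below :: "('a, 'b) gorder_scheme \<Rightarrow> 'a set \<Rightarrow> 'a set \<Rightarrow> bool" where
  "way_below L A B \<longleftrightarrow>
     (\<forall>D d. directed L D \<and> is_lub L d D \<and> d \<in> up L B \<longrightarrow> D \<inter> up L A \<noteq> {})"

definition filtered :: "'a set set \<Rightarrow> bool" where
  "filtered \<F> \<longleftrightarrow> \<F> \<noteq> {} \<and> (\<forall>U\<in>\<F>. \<forall>V\<in>\<F>. \<exists>W\<in>\<F>. W \<subseteq> U \<and> W \<subseteq> V)"

definition compact_fin_nbhds :: "('a, 'b) gorder_scheme \<Rightarrow> 'a \<Rightarrow> 'a set set" where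
  "compact_fin_nbhds L x =
     {up L F | F. F \<subseteq> carrier L \<and> finite F \<and> x \<in> up L F \<and> way_below L F F}"

definition quasialgebraic :: "('a, 'b) gorder_scheme \<Rightarrow> bool" where
  "quasialgebraic L \<longleftrightarrow>
     (\<forall>x\<in>carrier L. filtered (compact_fin_nbhds L x) \<and>
        \<Inter> (compact_fin_nbhds L x) = up L {x})"


section \<open>The binary tree with the unit interval on top\<close>

definition cylinder :: "bool list \<Rightarrow> (nat \<Rightarrow> bool) set" where
  "cylinder s = {\<alpha>. s = map \<alpha> [0..<length s]}"

definition binary_value :: "(nat \<Rightarrow> bool) \<Rightarrow> real" where
  "binary_value \<alpha> = (\<Sum>n. of_bool (\<alpha> n) / 2 ^ (n + 1))"

fun tree_le :: "bool list + real \<Rightarrow> bool list + real \<Rightarrow> bool" where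
  "tree_le (Inl s) (Inl t) \<longleftrightarrow> prefix s t"
| "tree_le (Inl s) (Inr r) \<longleftrightarrow> r \<in> binary_value ` cylinder s"
| "tree_le (Inr r) (Inr q) \<longleftrightarrow> r = q"
| "tree_le (Inr r) (Inl s) \<longleftrightarrow> False"

definition tree_interval :: "(bool list + real) gorder" where
  "tree_interval = \<lparr>carrier = UNIV <+> {0..1}, eq = (=), le = tree_le\<rparr>"

end

theory Submission
  imports Defs
begin

text \<open>If \<open>F\<close> is finite and \<open>F \<lless> F\<close>, then the sequences \<open>\<alpha>\<close> with \<open>\<pi>(\<alpha>) \<in> \<up>F\<close> are determined by
  their first \<open>N\<close> digits for some \<open>N\<close>, since \<open>\<pi>(\<alpha>)\<close> is the supremum of the prefixes of \<open>\<alpha>\<close>.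
  Membership depends only on the value, so it also passes from \<open>w0111\<dots>\<close> to \<open>w1000\<dots>\<close>. Together these
  carry it from \<open>000\<dots>\<close> to \<open>111\<dots>\<close>. Hence every such \<open>\<up>F\<close> that contains \<open>0\<close> also contains \<open>1\<close>, and
  the intersection of these sets is not \<open>\<up>0 = {0}\<close>.\<close>

section \<open>Values of binary sequences\<close>

lemma summable_digits: "summable (\<lambda>n. of_bool (\<alpha> n) / 2 ^ (n + 1) :: real)"
proof (rule summable_comparison_test')
  show "summable (\<lambda>n. (1/2) ^ n :: real)" by (rule summable_geometric) simp
qed (simp add: power_one_over field_simps)

lemma suminf_halves: "(\<Sum>n. 1 / 2 ^ (n + 1) :: real) = 1"
  using power_half_series by (simp add: sums_iff power_one_over)

lemma binary_value_False: "binary_value (\<lambda>_. False) = 0"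
  by (simp add: binary_value_def)

lemma binary_value_True: "binary_value (\<lambda>_. True) = 1"
  using suminf_halves by (simp add: binary_value_def)

lemma binary_value_bounds: "0 \<le> binary_value \<alpha>" "binary_value \<alpha> \<le> 1"
proof -
  show "0 \<le> binary_value \<alpha>"
    unfolding binary_value_def by (rule suminf_nonneg[OF summable_digits]) simp
  have "binary_value \<alpha> \<le> binary_value (\<lambda>_. True)"
    unfolding binary_value_def
    by (rule suminf_le[OF _ summable_digits summable_digits]) (simp add: divide_right_mono)
  then show "binary_value \<alpha> \<le> 1" by (simp add: binary_value_True)
qed

lemma binary_value_split:
  "binary_value \<alpha> =
     (\<Sum>i<n. of_bool (\<alpha> i) / 2 ^ (i + 1)) + binary_value (\<lambda>i. \<alpha> (i + n)) / 2 ^ n"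
proof -
  have "(\<Sum>i. of_bool (\<alpha> (i + n)) / 2 ^ (i + n + 1) :: real)
      = (\<Sum>i. of_bool (\<alpha> (i + n)) / 2 ^ (i + 1) / 2 ^ n)"
    by (simp add: power_add mult_ac)
  also have "\<dots> = binary_value (\<lambda>i. \<alpha> (i + n)) / 2 ^ n"
    unfolding binary_value_def by (rule suminf_divide[OF summable_digits])
  finally show ?thesis
    using suminf_split_initial_segment[OF summable_digits, of \<alpha> n]
    by (simp add: binary_value_def)
qed

text \<open>The initial sums in \<open>binary_value_split\<close> cancel, which leaves the
  difference of two tail values in [0,1], scaled by 1/2^n.\<close>

lemma binary_value_eq_prefix:
  assumes "\<And>i. i < n \<Longrightarrow> \<alpha> i = \<beta> i"
  shows "\<bar>binary_value \<alpha> - binary_value \<beta>\<bar> \<le> 1 / 2 ^ n"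
proof -
  let ?a = "binary_value (\<lambda>i. \<alpha> (i + n))" and ?b = "binary_value (\<lambda>i. \<beta> (i + n))"
  have "binary_value \<alpha> - binary_value \<beta> = (?a - ?b) / 2 ^ n"
    unfolding binary_value_split[of \<alpha> n] binary_value_split[of \<beta> n]
    using assms by (simp add: diff_divide_distrib)
  moreover have "\<bar>?a - ?b\<bar> \<le> 1"
    using binary_value_bounds[of "\<lambda>i. \<alpha> (i + n)"] binary_value_bounds[of "\<lambda>i. \<beta> (i + n)"]
    by linarith
  ultimately show ?thesis by (simp add: abs_divide divide_right_mono)
qed

text \<open>For \<open>b\<close> false or true this is the sequence of least or greatest value in
  the cylinder of \<open>w\<close>: the two endpoints of a dyadic interval.\<close>

definition pad :: "bool list \<Rightarrow> bool \<Rightarrow> nat \<Rightarrow> bool" where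
  "pad w b i = (if i < length w then w ! i else b)"

lemma pad_Nil: "pad [] b = (\<lambda>_. b)"
  by (simp add: pad_def fun_eq_iff)

lemma pad_append_same: "pad (w @ [b]) b = pad w b"
  by (auto simp: pad_def fun_eq_iff nth_append)

text \<open>The ones after position \<open>length w\<close> add up to the weight of that position.
  The double expansion of dyadic rationals links neighbouring cylinders.\<close>

lemma binary_value_pad_carry:
  "binary_value (pad (w @ [False]) True) = binary_value (pad (w @ [True]) False)"
proof -
  have tail: "(\<lambda>i. pad (w @ [b]) c (i + Suc (length w))) = (\<lambda>_. c)" for b c
    by (simp add: pad_def)
  have sum: "(\<Sum>i<length w. of_bool (pad (w @ [b]) c i) / 2 ^ (i + 1) :: real)
      = (\<Sum>i<length w. of_bool (w ! i) / 2 ^ (i + 1))" for b c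
    by (rule sum.cong) (auto simp: pad_def nth_append)
  have val: "binary_value (pad (w @ [b]) c) = (\<Sum>i<length w. of_bool (w ! i) / 2 ^ (i + 1))
      + of_bool b / 2 ^ Suc (length w) + binary_value (\<lambda>_. c) / 2 ^ Suc (length w)" for b c
    using sum[of b c] tail[of b c]
    by (subst binary_value_split[of _ "Suc (length w)"]) (simp add: pad_def)
  show ?thesis
    by (simp add: val binary_value_True binary_value_False)
qed

section \<open>Cylinders and the partial order\<close>

lemma mem_cylinder_iff: "\<alpha> \<in> cylinder s \<longleftrightarrow> (\<forall>i<length s. s ! i = \<alpha> i)"
  unfolding cylinder_def mem_Collect_eq by (subst list_eq_iff_nth_eq) simp

lemma cylinder_antimono: "prefix s t \<Longrightarrow> cylinder t \<subseteq> cylinder s"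
proof
  fix \<alpha> assume "prefix s t" "\<alpha> \<in> cylinder t"
  moreover from this have "s ! i = t ! i \<and> i < length t" if "i < length s" for i
    using that by (auto simp: prefix_def nth_append)
  ultimately show "\<alpha> \<in> cylinder s" by (simp add: mem_cylinder_iff)
qed

lemma cylinder_linear:
  assumes "\<alpha> \<in> cylinder s" "\<alpha> \<in> cylinder t" "length s \<le> length t"
  shows "prefix s t"
proof -
  have "s = take (length s) t"
    by (rule nth_equalityI) (use assms in \<open>simp_all add: mem_cylinder_iff\<close>)
  then show ?thesis by (metis take_is_prefix)
qed

lemma binary_value_cylinder:
  assumes "\<alpha> \<in> cylinder s" "\<beta> \<in> cylinder s"
  shows "\<bar>binary_value \<alpha> - binary_value \<beta>\<bar> \<le> 1 / 2 ^ length s"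
  using assms by (intro binary_value_eq_prefix) (auto simp: mem_cylinder_iff)

lemma tree_interval_simps [simp]:
  "le tree_interval = tree_le" "eq tree_interval = (=)"
  "Inl s \<in> carrier tree_interval" "Inr r \<in> carrier tree_interval \<longleftrightarrow> 0 \<le> r \<and> r \<le> 1"
  by (auto simp: tree_interval_def)

lemma tree_le_Inr_left: "tree_le (Inr r) p \<longleftrightarrow> p = Inr r"
  by (cases p) auto

lemma tree_le_refl: "tree_le p p"
  by (cases p) auto

lemma tree_le_antisym: "tree_le p q \<Longrightarrow> tree_le q p \<Longrightarrow> p = q"
  by (cases p; cases q) auto

lemma tree_le_trans: "tree_le p q \<Longrightarrow> tree_le q r \<Longrightarrow> tree_le p r"
  by (cases p; cases q; cases r)
    (auto intro: prefix_order.trans intro!: image_eqI dest: subsetD[OF cylinder_antimono])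

lemma partial_order_tree_interval: "partial_order tree_interval"
  by unfold_locales (simp_all add: tree_le_refl, blast dest: tree_le_antisym, blast dest: tree_le_trans)

section \<open>Suprema of directed sets\<close>

lemma is_lub_tree_interval_iff:
  assumes "D \<subseteq> carrier tree_interval"
  shows "is_lub tree_interval d D \<longleftrightarrow> d \<in> carrier tree_interval \<and> (\<forall>p\<in>D. tree_le p d) \<and>
    (\<forall>u\<in>carrier tree_interval. (\<forall>p\<in>D. tree_le p u) \<longrightarrow> tree_le d u)"
proof -
  have "Upper tree_interval D = {u \<in> carrier tree_interval. \<forall>p\<in>D. tree_le p u}"
    using assms by (auto simp: Upper_def)
  then show ?thesis by (auto simp: least_def)
qed

text \<open>No word bounds arbitrarily long words. A real upper bound lies in the image of every
  cylinder involved, and these images have diameters tending to 0, so it equals the value of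
  \<alpha>.\<close>

lemma is_lub_unbounded_chain:
  assumes sub: "D \<subseteq> Inl ` {s. \<alpha> \<in> cylinder s}"
    and unb: "\<And>n. \<exists>s. Inl s \<in> D \<and> n \<le> length s"
  shows "is_lub tree_interval (Inr (binary_value \<alpha>)) D"
proof -
  have carr: "D \<subseteq> carrier tree_interval" using sub by auto
  have least: "tree_le (Inr (binary_value \<alpha>)) u" if ub: "\<forall>p\<in>D. tree_le p u" for u
  proof (cases u)
    case (Inl t)
    obtain s where "Inl s \<in> D" "Suc (length t) \<le> length s" using unb by blast
    with ub Inl show ?thesis by (auto dest!: bspec prefix_length_le)
  next
    case (Inr r)
    have close: "\<bar>binary_value \<alpha> - r\<bar> \<le> (1/2) ^ n" for n
    proof -
      obtain s where s: "Inl s \<in> D" "n \<le> length s" using unb by blast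
      then obtain \<beta> where \<beta>: "\<beta> \<in> cylinder s" "r = binary_value \<beta>" using ub Inr by fastforce
      have "\<bar>binary_value \<alpha> - r\<bar> \<le> (1/2) ^ length s"
        using binary_value_cylinder[of \<alpha> s \<beta>] \<beta> s sub by (auto simp: power_one_over)
      also have "\<dots> \<le> (1/2) ^ n" using s by (intro power_decreasing) auto
      finally show ?thesis .
    qed
    have "\<bar>binary_value \<alpha> - r\<bar> \<le> 0"
      by (rule LIMSEQ_le_const[OF LIMSEQ_realpow_zero[of "1/2"]]) (use close in auto)
    then show ?thesis using Inr by simp
  qed
  show ?thesis
    unfolding is_lub_tree_interval_iff[OF carr]
    using sub least by (auto simp: binary_value_bounds)
qed

text \<open>Either \<open>D\<close> has a greatest element (a real, or a longest word), or its words
  are unboundedly long and spell out a single sequence, whose value is the supremum.\<close>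

lemma dcpo_tree_interval: "dcpo tree_interval"
  unfolding dcpo_def
proof (intro conjI allI impI partial_order_tree_interval)
  fix D assume "directed tree_interval D"
  then have carr: "D \<subseteq> carrier tree_interval" and ne: "D \<noteq> {}"
    and dir: "\<And>p q. p \<in> D \<Longrightarrow> q \<in> D \<Longrightarrow> \<exists>z\<in>D. tree_le p z \<and> tree_le q z"
    by (auto simp: directed_def)
  have max: "\<exists>d. is_lub tree_interval d D" if "m \<in> D" "\<forall>p\<in>D. tree_le p m" for m
    using that carr by (intro exI[of _ m]) (auto simp: is_lub_tree_interval_iff[OF carr])
  show "\<exists>d. is_lub tree_interval d D"
  proof (cases "\<exists>r. Inr r \<in> D")
    case True
    then obtain r where "Inr r \<in> D" by blast
    \<comment> \<open>Reals are maximal, so a common upper bound of \<open>Inr r\<close> and any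
      other member must be \<open>Inr r\<close> itself.\<close>
    then show ?thesis using max[of "Inr r"] dir[of "Inr r"] by (auto simp: tree_le_Inr_left)
  next
    case False
    then have Inl: "\<exists>s. p = Inl s" if "p \<in> D" for p
      using that by (cases p) auto
    \<comment> \<open>Without reals in \<open>D\<close>, a common upper bound is a word, and two
      prefixes of one word are comparable.\<close>
    have pref: "prefix s t" if st: "Inl s \<in> D" "Inl t \<in> D" and le: "length s \<le> length t" for s t
    proof -
      obtain z where "z \<in> D" "tree_le (Inl s) z" "tree_le (Inl t) z"
        using dir[OF st] by blast
      then obtain u where "prefix s u" "prefix t u" using Inl by fastforce
      then show ?thesis using le by (rule prefix_length_prefix)
    qed
    show ?thesis
    proof (cases "\<exists>n. \<forall>s. Inl s \<in> D \<longrightarrow> length s < n")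
      case True
      then obtain n where n: "\<forall>s. Inl s \<in> D \<longrightarrow> length s < n" by blast
      obtain s0 where "Inl s0 \<in> D" using ne Inl by blast
      then obtain s where s: "Inl s \<in> D" "\<forall>t. Inl t \<in> D \<longrightarrow> length t \<le> length s"
        using ex_has_greatest_nat[of "\<lambda>s. Inl s \<in> D" s0 length n] n by blast
      have "\<forall>p\<in>D. tree_le p (Inl s)" using Inl pref s by fastforce
      with s show ?thesis by (intro max)
    next
      case False
      then have unb: "\<exists>s. Inl s \<in> D \<and> n \<le> length s" for n by (meson not_le)
      then obtain w where w: "\<And>n. Inl (w n) \<in> D" "\<And>n. n \<le> length (w n)" by metis
      \<comment> \<open>The word \<open>w (Suc i)\<close> is long enough to have a digit at index
        \<open>i\<close>; by \<open>nth_eq\<close> any other long word of \<open>D\<close> gives the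
        same digit.\<close>
      define \<alpha> where "\<alpha> = (\<lambda>i. w (Suc i) ! i)"
      have nth_eq: "s ! i = t ! i"
        if "Inl s \<in> D" "Inl t \<in> D" "i < length s" "i < length t" for s t i
        using pref[OF that(1,2)] pref[OF that(2,1)] that(3,4)
        by (metis nat_le_linear prefix_def nth_append)
      have "\<alpha> \<in> cylinder s" if "Inl s \<in> D" for s
        unfolding mem_cylinder_iff \<alpha>_def
        using nth_eq[OF that w(1)] w(2)[THEN Suc_le_lessD] by blast
      then have "D \<subseteq> Inl ` {s. \<alpha> \<in> cylinder s}" using Inl by blast
      then show ?thesis using is_lub_unbounded_chain unb by blast
    qed
  qed
qed

section \<open>Finite sets way below themselves\<close>

text \<open>The prefixes of \<alpha> form a directed set with supremum the value of \<alpha>, so one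
  of them lies above a member of \<open>F\<close>. As no real lies below a word, that member is a
  word.\<close>

lemma way_below_self_has_prefix:
  assumes "way_below tree_interval F F" "Inr (binary_value \<alpha>) \<in> up tree_interval F"
  obtains s where "Inl s \<in> F" "\<alpha> \<in> cylinder s"
proof -
  let ?D = "Inl ` {s. \<alpha> \<in> cylinder s} :: (bool list + real) set"
  have len: "\<alpha> \<in> cylinder (map \<alpha> [0..<n])" for n by (simp add: mem_cylinder_iff)
  have lub: "is_lub tree_interval (Inr (binary_value \<alpha>)) ?D"
  proof (rule is_lub_unbounded_chain[OF subset_refl])
    show "\<exists>s. Inl s \<in> ?D \<and> n \<le> length s" for n
      using len by (intro exI[of _ "map \<alpha> [0..<n]"]) simp
  qed
  have "directed tree_interval ?D"
    unfolding directed_def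
  proof (intro conjI ballI)
    fix x y assume "x \<in> ?D" "y \<in> ?D"
    then obtain s t where "x = Inl s" "y = Inl t" "\<alpha> \<in> cylinder s" "\<alpha> \<in> cylinder t" by blast
    then show "\<exists>z\<in>?D. x \<sqsubseteq>\<^bsub>tree_interval\<^esub> z \<and> y \<sqsubseteq>\<^bsub>tree_interval\<^esub> z"
      using cylinder_linear[of \<alpha> s t] cylinder_linear[of \<alpha> t s]
      by (cases "length s \<le> length t") auto
  qed (use len in auto)
  then have "?D \<inter> up tree_interval F \<noteq> {}"
    using assms lub unfolding way_below_def by blast
  then obtain t a where t: "\<alpha> \<in> cylinder t" "a \<in> F" "tree_le a (Inl t)"
    by (auto simp: up_def)
  then obtain s where "a = Inl s" "prefix s t" by (cases a) auto
  with t that cylinder_antimono show thesis by blast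
qed

lemma way_below_self_zero_one:
  assumes "finite F" and wb: "way_below tree_interval F F"
    and zero: "Inr 0 \<in> up tree_interval F"
  shows "Inr 1 \<in> up tree_interval F"
proof -
  \<comment> \<open>\<open>good\<close> depends on \<alpha> only through its value, which is why it
    survives a carry.\<close>
  define good where "good = (\<lambda>\<alpha>. Inr (binary_value \<alpha>) \<in> up tree_interval F)"
  have "finite (Inl -` F :: bool list set)"
    using \<open>finite F\<close> by (simp add: finite_vimageI)
  then obtain N where N: "\<And>s. Inl s \<in> F \<Longrightarrow> length s \<le> N"
    using finite_nat_set_iff_bounded_le[of "length ` (Inl -` F :: bool list set)"] by auto
  have local: "good \<beta>" if "good \<alpha>" "\<And>i. i < N \<Longrightarrow> \<alpha> i = \<beta> i" for \<alpha> \<beta>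
  proof -
    obtain s where s: "Inl s \<in> F" "\<alpha> \<in> cylinder s"
      using way_below_self_has_prefix[OF wb] \<open>good \<alpha>\<close> unfolding good_def by blast
    then have "\<beta> \<in> cylinder s" using N that(2) by (fastforce simp: mem_cylinder_iff)
    then show ?thesis
      using s by (auto simp: good_def up_def binary_value_bounds intro!: bexI[of _ "Inl s"])
  qed
  \<comment> \<open>Crossing the cylinder of \<open>w\<close> from its least to its greatest
    sequence: once \<open>w\<close> has length at least \<open>N\<close>, both agree on the first
    \<open>N\<close> digits and \<open>local\<close> applies.\<close>
  have "good (pad w False) \<Longrightarrow> good (pad w True)" for w
  proof (induction "N - length w" arbitrary: w)
    case 0
    then show ?case by (elim local) (simp add: pad_def)
  next
    case (Suc n)
    then have IH: "good (pad (w @ [b]) False) \<Longrightarrow> good (pad (w @ [b]) True)" for b by simp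
    \<comment> \<open>The left half is crossed first, then the carry leads to the start of the right
      half, which is crossed last.\<close>
    have "good (pad (w @ [False]) True)" using IH Suc.prems by (simp add: pad_append_same)
    then have "good (pad (w @ [True]) False)" by (simp add: good_def binary_value_pad_carry)
    then show ?case using IH[of True] by (simp add: pad_append_same)
  qed
  from this[of "[]"] zero show ?thesis
    by (simp add: good_def pad_Nil binary_value_True binary_value_False)
qed

theorem theorem3p15:
  shows "dcpo tree_interval \<and> \<not> quasialgebraic tree_interval"
proof (rule conjI[OF dcpo_tree_interval], rule notI)
  assume "quasialgebraic tree_interval"
  then have "\<Inter> (compact_fin_nbhds tree_interval (Inr 0)) = up tree_interval {Inr 0}"
    by (simp add: quasialgebraic_def)
  \<comment> \<open>The point 0 is the witness: 1 lies in every set of its family but not above 0,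
    since distinct reals are incomparable.\<close>
  moreover have "Inr 1 \<in> \<Inter> (compact_fin_nbhds tree_interval (Inr 0))"
    by (auto simp: compact_fin_nbhds_def way_below_self_zero_one)
  ultimately show False by (simp add: up_def)
qed

end
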